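(* Let $H:\mathbb{R}\times\mathbb{R}^d\times\mathbb{R}^d\to\mathbb{R}$ be continuous, write $H_{t,x}=H(t,x,\cdot)$, let $T>0$, and let $u:\,]0,T[\times\mathbb{R}^d\to\mathbb{R}$ be a semi-concave solution of $\partial_tu+H(t,x,\partial_xu)=0$ (that is, $u$ is semi-concave and satisfies the equation at each of its points of differentiability). If $$H_{t,x}\leq\check H^u_{t,x}\quad\text{on }D_xu(t,x)$$ for each $(t,x)\in\,]0,T[\times\mathbb{R}^d$, then $u$ is a viscosity solution of the equation on $]0,T[\times\mathbb{R}^d$. Conversely, if $u$ is a viscosity solution of the equation, then $$H_{t,x}\leq\hat H^u_{t,x}\quad\text{on }D_xu(t,x)$$ for each $(t,x)\in\,]0,T[\times\mathbb{R}^d$.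
   Context: A function $u:\,]0,T[\times\mathbb{R}^d\to\mathbb{R}$ is semi-concave if $u(z)-B\|z\|^2/2$ ($z=(t,x)$) is concave for some constant $B$. $Du(t,x)\subset\mathbb{R}\times\mathbb{R}^d$ denotes its super-differential at $(t,x)$, i.e. the set of differentials at $(t,x)$ of $C^1$ functions having a contact from above with $u$ at $(t,x)$ (for semi-concave functions it coincides with the Clarke differential, the convex hull of limits of differentials at nearby points of differentiability). $D^eu(t,x)$ is the set of extremal points of the convex set $Du(t,x)$. Set $D_xu(t,x)=\{p\in\mathbb{R}^d:\exists\eta\in\mathbb{R},(\eta,p)\in Du(t,x)\}$ and $D^e_xu(t,x)=\{p\in\mathbb{R}^d:\exists\eta\in\mathbb{R},(\eta,p)\in D^eu(t,x)\}$. $\check H^u_{t,x}$ is the greatest convex function on $\mathbb{R}^d$ (values in $]-\infty,+\infty]$) which is smaller than or equal to $H_{t,x}$ on $D^e_xu(t,x)$; $\hat H^u_{t,x}$ is the smallest concave function on $\mathbb{R}^d$ (values in $[-\infty,+\infty[$) which is greater than or equal to $H_{t,x}$ on $D^e_xu(t,x)$. They equal $+\infty$ (resp. $-\infty$) outside of $D_xu(t,x)$. A continuous function $u$ is a viscosity solution if each smooth $\phi$ having a contact from above (resp. from below) with $u$ at a point $(t_0,x_0)$ satisfies $\partial_t\phi(t_0,x_0)+H(t_0,x_0,\partial_x\phi(t_0,x_0))\leq0$ (resp. $\geq0$). *)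

theory Defs
  imports "HOL-Analysis.Analysis"
begin

definition strip :: "real \<Rightarrow> (real \<times> 'a::euclidean_space) set" where
  "strip T = {0<..<T} \<times> UNIV"

definition semiconcave_on :: "'a::euclidean_space set \<Rightarrow> ('a \<Rightarrow> real) \<Rightarrow> bool" where
  "semiconcave_on S u \<longleftrightarrow> (\<exists>B. concave_on S (\<lambda>z. u z - B * (norm z)\<^sup>2 / 2))"

text \<open>Meant for open \<open>S\<close> only: \<open>frechet_derivative f (at x) v\<close> is the derivative of \<open>f\<close> at \<open>x\<close>
  in the direction \<open>v\<close>.\<close>

fun Ck_on :: "nat \<Rightarrow> 'a::euclidean_space set \<Rightarrow> ('a \<Rightarrow> real) \<Rightarrow> bool" where
  "Ck_on 0 S f \<longleftrightarrow> continuous_on S f"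
| "Ck_on (Suc k) S f \<longleftrightarrow>
     (\<forall>x\<in>S. f differentiable (at x)) \<and> (\<forall>v. Ck_on k S (\<lambda>x. frechet_derivative f (at x) v))"

definition smooth_on :: "'a::euclidean_space set \<Rightarrow> ('a \<Rightarrow> real) \<Rightarrow> bool" where
  "smooth_on S f \<longleftrightarrow> (\<forall>k. Ck_on k S f)"

text \<open>Contact is local, so at a point of an open domain only the values of \<open>u\<close> in that domain
  matter.\<close>

definition contact_above :: "('a::topological_space \<Rightarrow> real) \<Rightarrow> ('a \<Rightarrow> real) \<Rightarrow> 'a \<Rightarrow> bool" where
  "contact_above \<phi> u z \<longleftrightarrow> \<phi> z = u z \<and> (\<forall>\<^sub>F w in nhds z. u w \<le> \<phi> w)"

definition contact_below :: "('a::topological_space \<Rightarrow> real) \<Rightarrow> ('a \<Rightarrow> real) \<Rightarrow> 'a \<Rightarrow> bool" where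
  "contact_below \<phi> u z \<longleftrightarrow> \<phi> z = u z \<and> (\<forall>\<^sub>F w in nhds z. \<phi> w \<le> u w)"

text \<open>Differentials are represented by gradients with respect to the Euclidean inner product; on
  \<open>real \<times> 'a\<close> the gradient of \<open>\<phi>\<close> is the pair of its time derivative and its space gradient.\<close>

definition superdiff :: "('a::euclidean_space \<Rightarrow> real) \<Rightarrow> 'a \<Rightarrow> 'a set" where
  "superdiff u z =
     {q. \<exists>\<phi> U. open U \<and> z \<in> U \<and> Ck_on 1 U \<phi> \<and> contact_above \<phi> u z \<and> GDERIV \<phi> z :> q}"

definition superdiff_ext :: "('a::euclidean_space \<Rightarrow> real) \<Rightarrow> 'a \<Rightarrow> 'a set" where
  "superdiff_ext u z = {q. q extreme_point_of superdiff u z}"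

definition superdiff_x :: "(real \<times> 'a::euclidean_space \<Rightarrow> real) \<Rightarrow> real \<Rightarrow> 'a \<Rightarrow> 'a set" where
  "superdiff_x u t x = {p. \<exists>\<eta>. (\<eta>, p) \<in> superdiff u (t, x)}"

definition superdiff_ext_x :: "(real \<times> 'a::euclidean_space \<Rightarrow> real) \<Rightarrow> real \<Rightarrow> 'a \<Rightarrow> 'a set" where
  "superdiff_ext_x u t x = {p. \<exists>\<eta>. (\<eta>, p) \<in> superdiff_ext u (t, x)}"

text \<open>Convex functions with values in \<open>]-\<infinity>, +\<infinity>]\<close> and concave functions with values in
  \<open>[-\<infinity>, +\<infinity>[\<close>. In \<open>ereal\<close>, \<open>0 * \<infinity> = 0\<close>, so the end points \<open>a = 0\<close> and \<open>b = 0\<close> are harmless.\<close>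

definition convex_ereal :: "('a::real_vector \<Rightarrow> ereal) \<Rightarrow> bool" where
  "convex_ereal f \<longleftrightarrow> (\<forall>x. f x \<noteq> -\<infinity>) \<and>
     (\<forall>x y a b. 0 \<le> a \<longrightarrow> 0 \<le> b \<longrightarrow> a + b = 1 \<longrightarrow>
        f (a *\<^sub>R x + b *\<^sub>R y) \<le> ereal a * f x + ereal b * f y)"

definition concave_ereal :: "('a::real_vector \<Rightarrow> ereal) \<Rightarrow> bool" where
  "concave_ereal f \<longleftrightarrow> convex_ereal (\<lambda>x. - f x)"

text \<open>\<open>GREATEST\<close> and \<open>LEAST\<close> refer to the pointwise order on functions.\<close>

definition convex_hull_fun :: "'a::real_vector set \<Rightarrow> ('a \<Rightarrow> real) \<Rightarrow> 'a \<Rightarrow> ereal" where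
  "convex_hull_fun S h = (GREATEST g. convex_ereal g \<and> (\<forall>p\<in>S. g p \<le> ereal (h p)))"

definition concave_hull_fun :: "'a::real_vector set \<Rightarrow> ('a \<Rightarrow> real) \<Rightarrow> 'a \<Rightarrow> ereal" where
  "concave_hull_fun S h = (LEAST g. concave_ereal g \<and> (\<forall>p\<in>S. ereal (h p) \<le> g p))"

definition H_check ::
  "(real \<Rightarrow> 'a::euclidean_space \<Rightarrow> 'a \<Rightarrow> real) \<Rightarrow> (real \<times> 'a \<Rightarrow> real) \<Rightarrow> real \<Rightarrow> 'a \<Rightarrow> 'a \<Rightarrow> ereal"
  where "H_check H u t x = convex_hull_fun (superdiff_ext_x u t x) (H t x)"

definition H_hat ::
  "(real \<Rightarrow> 'a::euclidean_space \<Rightarrow> 'a \<Rightarrow> real) \<Rightarrow> (real \<times> 'a \<Rightarrow> real) \<Rightarrow> real \<Rightarrow> 'a \<Rightarrow> 'a \<Rightarrow> ereal"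
  where "H_hat H u t x = concave_hull_fun (superdiff_ext_x u t x) (H t x)"

definition semiconcave_solution ::
  "real \<Rightarrow> (real \<Rightarrow> 'a::euclidean_space \<Rightarrow> 'a \<Rightarrow> real) \<Rightarrow> (real \<times> 'a \<Rightarrow> real) \<Rightarrow> bool" where
  "semiconcave_solution T H u \<longleftrightarrow> semiconcave_on (strip T) u \<and>
     (\<forall>t x \<eta> p. (t, x) \<in> strip T \<longrightarrow> GDERIV u (t, x) :> (\<eta>, p) \<longrightarrow> \<eta> + H t x p = 0)"

definition viscosity_solution ::
  "real \<Rightarrow> (real \<Rightarrow> 'a::euclidean_space \<Rightarrow> 'a \<Rightarrow> real) \<Rightarrow> (real \<times> 'a \<Rightarrow> real) \<Rightarrow> bool" where
  "viscosity_solution T H u \<longleftrightarrow> continuous_on (strip T) u \<and>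
     (\<forall>t x \<phi> U \<eta> p. (t, x) \<in> strip T \<longrightarrow> open U \<longrightarrow> (t, x) \<in> U \<longrightarrow> smooth_on U \<phi> \<longrightarrow>
        GDERIV \<phi> (t, x) :> (\<eta>, p) \<longrightarrow>
        (contact_above \<phi> u (t, x) \<longrightarrow> \<eta> + H t x p \<le> 0) \<and>
        (contact_below \<phi> u (t, x) \<longrightarrow> \<eta> + H t x p \<ge> 0))"

end

theory Submission
  imports Defs
begin

text \<open>
  At a point \<open>z\<close> the superdifferential is the compact convex set of all \<open>q\<close> for which
  \<open>u w \<le> u z + q \<bullet> (w - z) + B |w - z|\<^sup>2 / 2\<close> holds globally. Where a smooth function touches \<open>u\<close>
  from below, semi-concavity makes \<open>u\<close> differentiable; this settles contacts from below, and it also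
  shows that points of differentiability are dense. By a separation argument the superdifferential
  is the convex hull of the limits of gradients at nearby points, so its extreme points \<open>(\<eta>, p)\<close> are
  such limits and satisfy \<open>\<eta> + H t x p = 0\<close> by continuity of \<open>H\<close>. By Minkowski's theorem any
  \<open>(\<eta>, p)\<close> in the superdifferential is a convex combination of extreme points, hence
  \<open>H_check H u t x p \<le> - \<eta> \<le> H_hat H u t x p\<close>. The viscosity inequality for contacts from above is
  \<open>H t x p \<le> - \<eta>\<close> for all such pairs, which gives both implications.
\<close>

section \<open>Differentiability between two contacts, and smooth quadratic test functions\<close>

text \<open>All three functions agree at \<open>z\<close>, so the normalised first-order remainder
  of \<open>f\<close> is squeezed between those of \<open>\<phi>\<close> and \<open>\<psi>\<close>,
  which tend to 0.\<close>

lemma GDERIV_sandwich: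
  fixes f :: "'a::euclidean_space \<Rightarrow> real"
  assumes "GDERIV \<phi> z :> q" "GDERIV \<psi> z :> q" "contact_below \<phi> f z" "contact_above \<psi> f z"
  shows "GDERIV f z :> q"
proof -
  have eq: "\<phi> z = f z" "\<psi> z = f z"
    and lo: "\<forall>\<^sub>F y in at z. \<phi> y \<le> f y" and up: "\<forall>\<^sub>F y in at z. f y \<le> \<psi> y"
    using assms(3,4) by (auto simp: contact_below_def contact_above_def eventually_nhds_conv_at)
  let ?Q = "\<lambda>f y. (1 / norm (y - z)) *\<^sub>R (f y - (f z + (y - z) \<bullet> q))"
  have "(?Q f \<longlongrightarrow> 0) (at z)"
  proof (rule tendsto_sandwich)
    show "(?Q \<phi> \<longlongrightarrow> 0) (at z)" "(?Q \<psi> \<longlongrightarrow> 0) (at z)"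
      using assms(1,2) by (auto simp: gderiv_def has_derivative_within)
    show "\<forall>\<^sub>F y in at z. ?Q \<phi> y \<le> ?Q f y"
      using lo by eventually_elim (auto simp: eq intro!: divide_right_mono)
    show "\<forall>\<^sub>F y in at z. ?Q f y \<le> ?Q \<psi> y"
      using up by eventually_elim (auto simp: eq intro!: divide_right_mono)
  qed
  then show ?thesis
    by (simp add: gderiv_def has_derivative_within bounded_linear_inner_left)
qed

lemma GDERIV_quadratic:
  fixes z :: "'a::euclidean_space"
  shows "GDERIV (\<lambda>w. c + q \<bullet> (w - z) + B / 2 * (norm (w - z))\<^sup>2) w :> q + B *\<^sub>R (w - z)"
  unfolding gderiv_def power2_norm_eq_inner
  by (auto intro!: derivative_eq_intros simp: algebra_simps inner_commute)

text \<open>Directional derivatives of such a function are affine, hence again of this form with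
  quadratic coefficient 0. The induction therefore generalises over \<open>c\<close>,
  \<open>q\<close> and \<open>B\<close>.\<close>

lemma smooth_on_quadratic:
  fixes z :: "'a::euclidean_space"
  shows "smooth_on UNIV (\<lambda>w. c + q \<bullet> (w - z) + B / 2 * (norm (w - z))\<^sup>2)"
proof -
  have "Ck_on k UNIV (\<lambda>w. c + q \<bullet> (w - z) + B / 2 * (norm (w - z))\<^sup>2)" for k
  proof (induction k arbitrary: c q B)
    case 0
    show ?case by (auto intro!: continuous_intros)
  next
    case (Suc k)
    let ?f = "\<lambda>w. c + q \<bullet> (w - z) + B / 2 * (norm (w - z))\<^sup>2"
    have D: "(?f has_derivative (\<lambda>h. h \<bullet> (q + B *\<^sub>R (w - z)))) (at w)" for w
      using GDERIV_quadratic[of c q z B w] by (simp add: gderiv_def)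
    \<comment> \<open>The vanishing last term is kept so that the right-hand side matches the
      induction hypothesis literally.\<close>
    have "frechet_derivative ?f (at w) v = q \<bullet> v + (B *\<^sub>R v) \<bullet> (w - z) + 0 / 2 * (norm (w - z))\<^sup>2"
      for w v
      by (subst frechet_derivative_at[OF D, symmetric]) (simp add: algebra_simps inner_commute)
    then show ?case
      using D Suc.IH[of "q \<bullet> v" "B *\<^sub>R v" 0 for v] by (auto simp: differentiable_def)
  qed
  then show ?thesis by (simp add: smooth_on_def)
qed

lemma smooth_on_imp_C1: "smooth_on U \<phi> \<Longrightarrow> Ck_on 1 U \<phi>"
  by (simp only: smooth_on_def)

section \<open>Semi-concave functions, their superdifferentials and contacts\<close>

locale semiconcave =
  fixes S :: "'a::euclidean_space set" and u :: "'a \<Rightarrow> real" and B :: real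
  assumes open_S: "open S"
    and concave: "concave_on S (\<lambda>z. u z - B * (norm z)\<^sup>2 / 2)"
begin

text \<open>Along a segment the squared norm falls short of its chord by exactly
  \<open>s * (1 - s)\<close> times the squared length, so concavity of \<open>u\<close> minus the
  paraboloid turns into this chord inequality with a quadratic defect.\<close>

lemma chord_bound:
  assumes "z \<in> S" "w \<in> S" "0 \<le> s" "s \<le> 1"
  shows "(1 - s) * u z + s * u w - B / 2 * (s * (1 - s)) * (norm (w - z))\<^sup>2 \<le> u (z + s *\<^sub>R (w - z))"
proof -
  have "(1 - s) * (u z - B * (norm z)\<^sup>2 / 2) + s * (u w - B * (norm w)\<^sup>2 / 2)
      \<le> u ((1 - s) *\<^sub>R z + s *\<^sub>R w) - B * (norm ((1 - s) *\<^sub>R z + s *\<^sub>R w))\<^sup>2 / 2"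
    using concave assms unfolding concave_on_iff by (auto dest!: bspec)
  moreover have "(1 - s) *\<^sub>R z + s *\<^sub>R w = z + s *\<^sub>R (w - z)"
    by (simp add: algebra_simps)
  moreover have "(norm (z + s *\<^sub>R (w - z)))\<^sup>2
      = (1 - s) * (norm z)\<^sup>2 + s * (norm w)\<^sup>2 - s * (1 - s) * (norm (w - z))\<^sup>2"
    by (simp add: power2_norm_eq_inner inner_commute algebra_simps)
  ultimately have "(1 - s) * (u z - B * (norm z)\<^sup>2 / 2) + s * (u w - B * (norm w)\<^sup>2 / 2)
      \<le> u (z + s *\<^sub>R (w - z))
        - B * ((1 - s) * (norm z)\<^sup>2 + s * (norm w)\<^sup>2 - s * (1 - s) * (norm (w - z))\<^sup>2) / 2"
    by simp
  then show ?thesis by (simp add: algebra_simps add_divide_distrib diff_divide_distrib)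
qed

lemma continuous_on_u: "continuous_on S u"
proof -
  have "continuous_on S (\<lambda>z. - (u z - B * (norm z)\<^sup>2 / 2))"
    using concave open_S convex_on_continuous by (auto simp: concave_on_def)
  then have "continuous_on S (\<lambda>z. B * (norm z)\<^sup>2 / 2 - - (u z - B * (norm z)\<^sup>2 / 2))"
    by (rule continuous_on_diff[rotated]) (auto intro!: continuous_intros)
  then show ?thesis by simp
qed

text \<open>Passes from local contact to a global bound. On the ray from \<open>z\<close> to
  \<open>w\<close> the chord inequality bounds the difference quotients of \<open>\<phi>\<close>
  from below, and letting \<open>s\<close> decrease to 0 leaves the directional derivative
  \<open>q \<bullet> (w - z)\<close>.\<close>

lemma contact_above_bound:
  assumes "z \<in> S" "w \<in> S" "contact_above \<phi> u z" and q: "GDERIV \<phi> z :> q"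
  shows "u w \<le> u z + q \<bullet> (w - z) + B / 2 * (norm (w - z))\<^sup>2"
proof -
  define h where "h = w - z"
  have ray: "((\<lambda>s. z + s *\<^sub>R h) \<longlongrightarrow> z) (at_right 0)"
    by (auto intro!: tendsto_eq_intros)
  have "((\<lambda>s. \<phi> (z + s *\<^sub>R h)) has_derivative (\<lambda>s. (s *\<^sub>R h) \<bullet> q)) (at 0)"
    by (rule has_derivative_compose[of "\<lambda>s. z + s *\<^sub>R h"])
       (use q in \<open>auto simp: gderiv_def intro!: derivative_eq_intros\<close>)
  then have "((\<lambda>s. \<phi> (z + s *\<^sub>R h)) has_field_derivative q \<bullet> h) (at 0)"
    by (simp add: has_field_derivative_def inner_commute mult.commute[of "q \<bullet> h"] cong: if_cong)
       (simp add: has_derivative_def mult_commute_abs)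
  then have lim: "((\<lambda>s. (\<phi> (z + s *\<^sub>R h) - \<phi> z) / s) \<longlongrightarrow> q \<bullet> h) (at_right 0)"
    using tendsto_mono[OF at_le[of "{0<..}" UNIV]] by (fastforce simp: DERIV_def)
  have "\<forall>\<^sub>F s in at_right 0. u (z + s *\<^sub>R h) \<le> \<phi> (z + s *\<^sub>R h)"
    using assms(3) filterlim_iff[THEN iffD1, OF ray] by (auto simp: contact_above_def)
  moreover have "\<forall>\<^sub>F s in at_right (0::real). 0 < s \<and> s < 1"
    by (auto simp: eventually_at_right_field intro!: exI[of _ 1])
  ultimately have "\<forall>\<^sub>F s in at_right 0.
      u w - u z - B / 2 * (1 - s) * (norm h)\<^sup>2 \<le> (\<phi> (z + s *\<^sub>R h) - \<phi> z) / s"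
  proof eventually_elim
    case (elim s)
    then have "s * (u w - u z - B / 2 * (1 - s) * (norm h)\<^sup>2) \<le> \<phi> (z + s *\<^sub>R h) - \<phi> z"
      using chord_bound[of z w s] assms by (simp add: h_def contact_above_def algebra_simps)
    then show ?case using elim by (simp add: field_simps)
  qed
  moreover have "((\<lambda>s. u w - u z - B / 2 * (1 - s) * (norm h)\<^sup>2) \<longlongrightarrow> u w - u z - B / 2 * (norm h)\<^sup>2)
      (at_right 0)"
    by (auto intro!: tendsto_eq_intros)
  ultimately have "u w - u z - B / 2 * (norm h)\<^sup>2 \<le> q \<bullet> h"
    using tendsto_le[OF _ lim] by force
  then show ?thesis by (simp add: h_def)
qed

lemma smooth_contact_above_quadratic:
  assumes "z \<in> S" "\<forall>w\<in>S. u w \<le> u z + q \<bullet> (w - z) + B / 2 * (norm (w - z))\<^sup>2"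
  obtains \<phi> where "smooth_on UNIV \<phi>" "contact_above \<phi> u z" "GDERIV \<phi> z :> q"
proof
  let ?\<phi> = "\<lambda>w. u z + q \<bullet> (w - z) + B / 2 * (norm (w - z))\<^sup>2"
  show "smooth_on UNIV ?\<phi>"
    by (rule smooth_on_quadratic)
  show "contact_above ?\<phi> u z"
    using open_S assms by (auto simp: contact_above_def eventually_nhds)
  show "GDERIV ?\<phi> z :> q"
    using GDERIV_quadratic[of "u z" q z B z] by simp
qed

text \<open>Replaces the existential over \<open>C^1\<close> functions by inequalities affine in
  \<open>q\<close>, with one constant \<open>B\<close> for all points of \<open>S\<close>.
  Closedness, convexity and bounds are all read off from this form.\<close>

lemma mem_superdiff_iff:
  assumes "z \<in> S"
  shows "q \<in> superdiff u z \<longleftrightarrow> (\<forall>w\<in>S. u w \<le> u z + q \<bullet> (w - z) + B / 2 * (norm (w - z))\<^sup>2)"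
proof
  assume "q \<in> superdiff u z"
  then show "\<forall>w\<in>S. u w \<le> u z + q \<bullet> (w - z) + B / 2 * (norm (w - z))\<^sup>2"
    using contact_above_bound[OF assms] by (auto simp: superdiff_def)
next
  assume "\<forall>w\<in>S. u w \<le> u z + q \<bullet> (w - z) + B / 2 * (norm (w - z))\<^sup>2"
  then obtain \<phi> where "smooth_on UNIV \<phi>" "contact_above \<phi> u z" "GDERIV \<phi> z :> q"
    using smooth_contact_above_quadratic[OF assms] by metis
  then show "q \<in> superdiff u z"
    unfolding superdiff_def using smooth_on_imp_C1 by blast
qed

text \<open>Bridges two classes of test functions: the superdifferential is defined by
  \<open>C^1\<close> contacts, whereas viscosity solutions are tested with smooth ones.\<close>

lemma smooth_contact_above_superdiff:
  assumes "z \<in> S" "q \<in> superdiff u z"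
  obtains \<phi> where "smooth_on UNIV \<phi>" "contact_above \<phi> u z" "GDERIV \<phi> z :> q"
  using assms smooth_contact_above_quadratic mem_superdiff_iff by metis

text \<open>\<open>u\<close> touches itself from above. It need not be \<open>C^1\<close> near
  \<open>z\<close>, but \<open>contact_above_bound\<close> asks for a gradient at \<open>z\<close>
  only.\<close>

lemma GDERIV_imp_mem_superdiff:
  assumes "z \<in> S" "GDERIV u z :> q"
  shows "q \<in> superdiff u z"
  using assms contact_above_bound[of z _ u q] by (auto simp: mem_superdiff_iff contact_above_def)

lemma GDERIV_if_contact_below:
  assumes "z \<in> S" and below: "contact_below \<phi> u z" and q: "GDERIV \<phi> z :> q"
  shows "GDERIV u z :> q"
proof (rule GDERIV_sandwich[OF q _ below])
  \<comment> \<open>\<open>u w + u (2 z - w) \<le> 2 u z + B |w - z|\<^sup>2\<close> reflects the lower contact into an upper one.\<close>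
  let ?\<psi> = "\<lambda>w. 2 * u z - \<phi> (2 *\<^sub>R z - w) + B * (norm (w - z))\<^sup>2"
  have "((\<lambda>w. \<phi> (2 *\<^sub>R z - w)) has_derivative (\<lambda>h. (- h) \<bullet> q)) (at z)"
    by (rule has_derivative_compose[of "\<lambda>w. 2 *\<^sub>R z - w"])
       (use q in \<open>auto simp: gderiv_def scaleR_2 intro!: derivative_eq_intros\<close>)
  then show "GDERIV ?\<psi> z :> q"
    unfolding gderiv_def power2_norm_eq_inner
    by (auto intro!: derivative_eq_intros)
  have refl: "((\<lambda>w. 2 *\<^sub>R z - w) \<longlongrightarrow> z) (nhds z)"
    by (auto intro!: tendsto_eq_intros filterlim_ident simp: scaleR_2)
  have S: "\<forall>\<^sub>F w in nhds z. w \<in> S"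
    using open_S assms(1) by (auto simp: eventually_nhds)
  have "\<forall>\<^sub>F w in nhds z. \<phi> w \<le> u w \<and> w \<in> S"
    using S below by (auto simp: contact_below_def eventually_conj_iff)
  then have "\<forall>\<^sub>F w in nhds z. \<phi> (2 *\<^sub>R z - w) \<le> u (2 *\<^sub>R z - w) \<and> 2 *\<^sub>R z - w \<in> S"
    using refl by (auto simp: filterlim_iff)
  with S have "\<forall>\<^sub>F w in nhds z. u w \<le> ?\<psi> w"
  proof eventually_elim
    case (elim w)
    have "norm ((2 *\<^sub>R z - w) - w) = 2 * norm (w - z)"
      by (metis (no_types, lifting) norm_minus_commute norm_scaleR abs_numeral diff_diff_eq scaleR_2
          scaleR_right_diff_distrib)
    moreover have "w + (1/2) *\<^sub>R ((2 *\<^sub>R z - w) - w) = z"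
      by (simp add: algebra_simps flip: scaleR_add_left)
    ultimately show ?case
      using chord_bound[of w "2 *\<^sub>R z - w" "1/2"] elim by (simp add: power_mult_distrib field_simps)
  qed
  then show "contact_above ?\<psi> u z"
    using below by (auto simp: contact_above_def contact_below_def scaleR_2)
qed

text \<open>Minimising \<open>u\<close> plus a steep paraboloid centred at \<open>z\<close> produces a point near \<open>z\<close> where a
  smooth function touches \<open>u\<close> from below.\<close>

lemma ex_GDERIV_near:
  assumes "z \<in> S" "0 < r"
  obtains w q where "w \<in> S" "dist w z < r" "GDERIV u w :> q"
proof -
  obtain e where e: "0 < e" "cball z e \<subseteq> S"
    using open_S assms(1) open_contains_cball by blast
  define d where "d = min e (r / 2)"
  have d: "0 < d" "cball z d \<subseteq> S" "d < r"
    using e assms(2) by (auto simp: d_def)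
  have cont: "continuous_on (cball z d) u"
    using continuous_on_u d(2) continuous_on_subset by blast
  have "bounded (u ` cball z d)"
    by (intro compact_imp_bounded compact_continuous_image cont compact_cball)
  then obtain K where K: "\<And>w. w \<in> cball z d \<Longrightarrow> \<bar>u w\<bar> \<le> K"
    unfolding bounded_iff by (metis image_eqI real_norm_def)
  \<comment> \<open>On the sphere of radius \<open>d\<close> the penalty equals
    \<open>2 * K + 1\<close>, more than the oscillation of \<open>u\<close> on the ball, so the
    minimiser cannot lie there.\<close>
  define M where "M = (2 * K + 1) / d\<^sup>2"
  have "continuous_on (cball z d) (\<lambda>w. u w + M * (norm (w - z))\<^sup>2)"
    by (intro continuous_intros cont)
  then have "\<exists>w\<in>cball z d. \<forall>y\<in>cball z d. u w + M * (norm (w - z))\<^sup>2 \<le> u y + M * (norm (y - z))\<^sup>2"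
    using d(1) by (intro continuous_attains_inf) auto
  then obtain w where w: "w \<in> cball z d"
    and min: "\<And>y. y \<in> cball z d \<Longrightarrow> u w + M * (norm (w - z))\<^sup>2 \<le> u y + M * (norm (y - z))\<^sup>2"
    by blast
  have "dist z w \<noteq> d"
  proof
    assume "dist z w = d"
    then have "M * (norm (w - z))\<^sup>2 = 2 * K + 1"
      using d(1) by (simp add: M_def dist_norm norm_minus_commute)
    then show False
      using min[of z] K[of z] K[OF w] d(1) by auto
  qed
  then have w': "w \<in> ball z d"
    using w by auto
  let ?\<phi> = "\<lambda>y. u w + M * (norm (w - z))\<^sup>2 - M * (norm (y - z))\<^sup>2"
  have "contact_below ?\<phi> u w"
    unfolding contact_below_def eventually_nhds
  proof (intro conjI exI[of _ "ball z d"] ballI)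
    fix y assume "y \<in> ball z d"
    then show "?\<phi> y \<le> u y" using min[of y] by simp
  qed (use w' in auto)
  moreover have "GDERIV ?\<phi> w :> - (2 * M) *\<^sub>R (w - z)"
    unfolding gderiv_def power2_norm_eq_inner
    by (auto intro!: derivative_eq_intros simp: algebra_simps inner_commute)
  ultimately have "GDERIV u w :> - (2 * M) *\<^sub>R (w - z)"
    using GDERIV_if_contact_below w d(2) by blast
  moreover have "w \<in> S" "dist w z < r"
    using w w' d by (auto simp: dist_commute)
  ultimately show thesis
    using that by blast
qed

section \<open>Compactness of superdifferentials and limits of gradients\<close>

text \<open>A step of length \<open>r\<close> from \<open>w\<close> against \<open>q\<close> lowers
  the linear term by \<open>r * norm q\<close>, while \<open>u\<close> varies by at most
  \<open>2 * M\<close>; this limits \<open>norm q\<close>.\<close>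

lemma superdiff_locally_bounded:
  assumes "z \<in> S"
  obtains r K where "0 < r" "\<And>w q. w \<in> ball z r \<Longrightarrow> q \<in> superdiff u w \<Longrightarrow> norm q \<le> K"
proof -
  obtain e where e: "0 < e" "cball z e \<subseteq> S"
    using open_S assms open_contains_cball by blast
  have "bounded (u ` cball z e)"
    using continuous_on_u e(2) continuous_on_subset
    by (intro compact_imp_bounded compact_continuous_image) auto
  then obtain M where M: "\<And>w. w \<in> cball z e \<Longrightarrow> \<bar>u w\<bar> \<le> M"
    unfolding bounded_iff by (metis image_eqI real_norm_def)
  \<comment> \<open>Half the radius, so that a step of length \<open>r\<close> from a point of
    \<open>ball z r\<close> stays in \<open>cball z e\<close>.\<close>
  define r where "r = e / 2"
  have "norm q \<le> (2 * M + \<bar>B\<bar> / 2 * r\<^sup>2) / r" if "w \<in> ball z r" "q \<in> superdiff u w" for w q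
  proof (cases "q = 0")
    case True
    have "0 \<le> M" using M[of z] e(1) by auto
    then show ?thesis using True e(1) by (simp add: r_def)
  next
    case False
    define y where "y = w - (r / norm q) *\<^sub>R q"
    have nyw: "norm (y - w) = r"
      using False e(1) by (simp add: y_def r_def)
    then have "dist z y \<le> e"
      using that(1) norm_triangle_le[of "z - w" "w - y" e] by (simp add: r_def dist_norm norm_minus_commute)
    moreover have w: "w \<in> cball z e" using that(1) e(1) by (simp add: r_def)
    ultimately have "u y \<le> u w + q \<bullet> (y - w) + B / 2 * (norm (y - w))\<^sup>2"
      using that(2) mem_superdiff_iff[of w q] e(2) by (meson mem_cball subsetD)
    moreover have "q \<bullet> (y - w) = - r * norm q"
      using False by (simp add: y_def power2_norm_eq_inner[symmetric] power2_eq_square)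
    moreover have "B / 2 * r\<^sup>2 \<le> \<bar>B\<bar> / 2 * r\<^sup>2"
      by (intro mult_right_mono) auto
    ultimately have "r * norm q \<le> 2 * M + \<bar>B\<bar> / 2 * r\<^sup>2"
      using M[OF w] M[of y] \<open>dist z y \<le> e\<close> nyw by simp
    then show ?thesis using e(1) by (simp add: r_def field_simps)
  qed
  moreover have "0 < r" using e(1) by (simp add: r_def)
  ultimately show thesis using that by blast
qed

text \<open>For each fixed \<open>y\<close> the global quadratic inequality passes to the limit,
  because \<open>u\<close> is continuous.\<close>

lemma superdiff_closed_graph:
  assumes "z \<in> S" "\<And>n. w n \<in> S" "\<And>n. q n \<in> superdiff u (w n)"
    and "w \<longlonglongrightarrow> z" "q \<longlonglongrightarrow> q0"
  shows "q0 \<in> superdiff u z"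
  unfolding mem_superdiff_iff[OF assms(1)]
proof
  fix y assume y: "y \<in> S"
  have "(\<lambda>n. u (w n)) \<longlonglongrightarrow> u z"
    using continuous_on_u assms by (auto intro: continuous_on_tendsto_compose)
  then have "(\<lambda>n. u (w n) + q n \<bullet> (y - w n) + B / 2 * (norm (y - w n))\<^sup>2)
      \<longlonglongrightarrow> u z + q0 \<bullet> (y - z) + B / 2 * (norm (y - z))\<^sup>2"
    by (intro tendsto_intros assms)
  then show "u y \<le> u z + q0 \<bullet> (y - z) + B / 2 * (norm (y - z))\<^sup>2"
    by (rule LIMSEQ_le_const) (use assms y mem_superdiff_iff in blast)
qed

lemma compact_superdiff:
  assumes "z \<in> S"
  shows "compact (superdiff u z)"
proof -
  obtain r K where "0 < r" "\<And>w q. w \<in> ball z r \<Longrightarrow> q \<in> superdiff u w \<Longrightarrow> norm q \<le> K"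
    using superdiff_locally_bounded[OF assms] by metis
  then have "bounded (superdiff u z)"
    unfolding bounded_iff by (metis centre_in_ball)
  moreover have "closed (superdiff u z)"
    unfolding closed_sequential_limits
    using superdiff_closed_graph[OF assms, of "\<lambda>_. z"] assms by auto
  ultimately show ?thesis by (simp add: compact_eq_bounded_closed)
qed

lemma convex_superdiff:
  assumes "z \<in> S"
  shows "convex (superdiff u z)"
proof -
  have "superdiff u z = (\<Inter>w\<in>S. {q. (w - z) \<bullet> q \<ge> u w - u z - B / 2 * (norm (w - z))\<^sup>2})"
    using mem_superdiff_iff[OF assms] by (auto simp: inner_commute algebra_simps)
  then show ?thesis by (auto intro!: convex_INT convex_halfspace_ge)
qed

text \<open>The gradients are taken at points approaching \<open>z\<close> from the direction \<open>e\<close>, so that the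
  almost-monotonicity of superdifferentials yields the inequality in the limit.\<close>

lemma ex_gradient_limit:
  assumes z: "z \<in> S" and q: "q \<in> superdiff u z"
  obtains g where "g \<in> superdiff u z" "(z, g) \<in> closure {(w, g). w \<in> S \<and> GDERIV u w :> g}"
    "e \<bullet> g \<le> e \<bullet> q"
proof -
  obtain r0 where r0: "0 < r0" "ball z r0 \<subseteq> S"
    using open_S z open_contains_ball by blast
  obtain r1 K where r1: "0 < r1" and K: "\<And>w q. w \<in> ball z r1 \<Longrightarrow> q \<in> superdiff u w \<Longrightarrow> norm q \<le> K"
    using superdiff_locally_bounded[OF z] by metis
  \<comment> \<open>Small enough that the points \<open>z + s n *\<^sub>R e\<close> lie in
    \<open>S\<close> and the nearby points \<open>w n\<close> lie in the ball where
    superdifferentials are bounded by \<open>K\<close>.\<close>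
  define \<delta> where "\<delta> = min 1 (min r0 r1 / (norm e + 2))"
  define s where "s n = \<delta> * inverse (real (Suc n))" for n
  have e2: "0 < norm e + 2" by (simp add: add_nonneg_pos)
  then have \<delta>: "0 < \<delta>" using r0 r1 by (simp add: \<delta>_def)
  have s: "0 < s n" "s n \<le> 1" "s n * (norm e + 1) < min r0 r1" for n
  proof -
    show "0 < s n" using \<delta> by (simp add: s_def)
    have "s n \<le> \<delta> * 1"
      unfolding s_def using \<delta> by (intro mult_left_mono) (auto simp: field_simps)
    then have le: "s n \<le> \<delta>" by simp
    then show "s n \<le> 1" by (simp add: \<delta>_def)
    have "s n * (norm e + 1) < s n * (norm e + 2)"
      using \<open>0 < s n\<close> by simp
    also have "\<dots> \<le> min r0 r1 / (norm e + 2) * (norm e + 2)"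
      using le e2 by (intro mult_right_mono) (auto simp: \<delta>_def)
    finally show "s n * (norm e + 1) < min r0 r1" using e2 by simp
  qed
  have s_lim: "s \<longlonglongrightarrow> 0"
    unfolding s_def by (intro tendsto_mult_right_zero LIMSEQ_inverse_real_of_nat)
  have in_S: "z + s n *\<^sub>R e \<in> S" for n
  proof -
    have "s n * norm e < r0"
      using s(1,3)[of n] by (simp add: distrib_left)
    then show ?thesis using s(1)[of n] r0(2) by (auto simp: dist_norm)
  qed
  \<comment> \<open>The tolerance is of second order in \<open>s n\<close>: after division by
    \<open>s n\<close> the error still vanishes, so the rescaled directions \<open>d n\<close>
    converge to \<open>e\<close>.\<close>
  have "\<exists>w g. w \<in> S \<and> dist w (z + s n *\<^sub>R e) < (s n)\<^sup>2 \<and> GDERIV u w :> g" for n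
    using ex_GDERIV_near[OF in_S, of "(s n)\<^sup>2" n] s(1)[of n] by (metis zero_less_power)
  then obtain w g where w: "\<And>n. w n \<in> S" "\<And>n. dist (w n) (z + s n *\<^sub>R e) < (s n)\<^sup>2"
    and g: "\<And>n. GDERIV u (w n) :> g n"
    by metis
  define d where "d n = (1 / s n) *\<^sub>R (w n - z)" for n
  have w_eq: "w n = z + s n *\<^sub>R d n" for n
    using s(1)[of n] by (simp add: d_def)
  have de: "norm (d n - e) < s n" for n
  proof -
    have "s n * norm (d n - e) = norm (s n *\<^sub>R (d n - e))"
      using s(1)[of n] by simp
    also have "\<dots> < s n * s n"
      using w(2)[of n] unfolding w_eq by (simp add: dist_norm power2_eq_square scaleR_diff_right)
    finally show ?thesis using s(1)[of n] by simp
  qed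
  have d_lim: "d \<longlonglongrightarrow> e"
  proof (rule LIM_zero_cancel, rule tendsto_norm_zero_cancel, rule tendsto_sandwich[OF _ _ tendsto_const s_lim])
    show "\<forall>\<^sub>F n in sequentially. norm (d n - e) \<le> s n"
      using de by (simp add: less_imp_le)
  qed simp
  have w_lim: "w \<longlonglongrightarrow> z"
    unfolding w_eq using tendsto_add[OF tendsto_const[of z] tendsto_scaleR[OF s_lim d_lim]] by simp
  have gu: "g n \<in> superdiff u (w n)" for n
    using GDERIV_imp_mem_superdiff w g by blast
  have "norm (g n) \<le> K" for n
  proof (rule K[OF _ gu])
    have "norm (d n) \<le> norm e + 1"
      using norm_triangle_sub[of "d n" e] de[of n] s(2)[of n] by linarith
    then have "s n * norm (d n) \<le> s n * (norm e + 1)"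
      using s(1)[of n] by (intro mult_left_mono) auto
    also have "\<dots> < r1"
      using s(3)[of n] by simp
    finally show "w n \<in> ball z r1"
      using s(1)[of n] by (auto simp: w_eq dist_norm)
  qed
  then have "bounded (range g)"
    by (auto simp: bounded_iff)
  then obtain g0 \<rho> where \<rho>: "strict_mono \<rho>" and g0: "(g \<circ> \<rho>) \<longlonglongrightarrow> g0"
    using bounded_imp_convergent_subsequence by blast
  have sub: "(\<lambda>n. f (\<rho> n)) \<longlonglongrightarrow> l" if "f \<longlonglongrightarrow> l" for f and l :: "'b::topological_space"
    using LIMSEQ_subseq_LIMSEQ[OF that \<rho>] by (simp add: o_def)
  have g_lim: "(\<lambda>n. g (\<rho> n)) \<longlonglongrightarrow> g0" using g0 by (simp add: o_def)
  have g0_mem: "g0 \<in> superdiff u z"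
    using superdiff_closed_graph[OF z _ _ sub[OF w_lim] g_lim] w gu by blast
  have g0_cl: "(z, g0) \<in> closure {(w, g). w \<in> S \<and> GDERIV u w :> g}"
    unfolding closure_sequential using w g
    by (intro exI[of _ "\<lambda>n. (w (\<rho> n), g (\<rho> n))"] conjI tendsto_Pair sub[OF w_lim] g_lim) auto
  \<comment> \<open>Add the superdifferential inequality at \<open>w n\<close> evaluated at
    \<open>z\<close> to the one at \<open>z\<close> evaluated at \<open>w n\<close>. The values of
    \<open>u\<close> cancel, and dividing by \<open>s n\<close> leaves an error that vanishes in the
    limit.\<close>
  have le: "g n \<bullet> d n \<le> q \<bullet> d n + B * s n * (norm (d n))\<^sup>2" for n
  proof -
    have "u z \<le> u (w n) + g n \<bullet> (z - w n) + B / 2 * (norm (z - w n))\<^sup>2"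
      using gu[of n] z w(1)[of n] by (simp add: mem_superdiff_iff)
    moreover have "u (w n) \<le> u z + q \<bullet> (w n - z) + B / 2 * (norm (w n - z))\<^sup>2"
      using q z w(1)[of n] by (simp add: mem_superdiff_iff)
    ultimately have "s n * (g n \<bullet> d n) \<le> s n * (q \<bullet> d n + B * s n * (norm (d n))\<^sup>2)"
      unfolding w_eq by (simp add: algebra_simps power2_eq_square)
    then show ?thesis using s(1)[of n] by simp
  qed
  have "(\<lambda>n. q \<bullet> d n + B * s n * (norm (d n))\<^sup>2) \<longlonglongrightarrow> q \<bullet> e + B * 0 * (norm e)\<^sup>2"
    by (intro tendsto_intros d_lim s_lim)
  then have "g0 \<bullet> e \<le> q \<bullet> e + B * 0 * (norm e)\<^sup>2"
    using LIMSEQ_le[OF tendsto_inner[OF g_lim sub[OF d_lim]] sub] le by blast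
  then show thesis
    using that[OF g0_mem g0_cl] by (simp add: inner_commute)
qed

text \<open>By \<open>ex_gradient_limit\<close> no linear functional goes lower on the
  superdifferential than on the set \<open>Z\<close> of limits of gradients, so the convex hull of
  \<open>Z\<close> is everything. An extreme point of a convex hull lies in the generating
  set.\<close>

lemma superdiff_ext_gradient_limit:
  assumes z: "z \<in> S" and q: "q \<in> superdiff_ext u z"
  shows "(z, q) \<in> closure {(w, g). w \<in> S \<and> GDERIV u w :> g}"
proof -
  define Z where "Z = superdiff u z \<inter> Pair z -` closure {(w, g). w \<in> S \<and> GDERIV u w :> g}"
  have "compact Z"
    unfolding Z_def
    by (intro compact_Int_closed compact_superdiff z continuous_closed_vimage) (auto intro!: continuous_intros)
  then have hull: "convex (convex hull Z)" "closed (convex hull Z)"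
    by (auto intro: compact_imp_closed compact_convex_hull)
  have "superdiff u z \<subseteq> convex hull Z"
  proof
    fix p assume p: "p \<in> superdiff u z"
    show "p \<in> convex hull Z"
    proof (rule ccontr)
      assume "p \<notin> convex hull Z"
      then obtain e b where e: "e \<bullet> p < b" "\<And>x. x \<in> convex hull Z \<Longrightarrow> e \<bullet> x > b"
        using separating_hyperplane_closed_point[OF hull] by metis
      \<comment> \<open>The normal \<open>e\<close> of the separating hyperplane serves as the
        direction of approach.\<close>
      obtain g where "g \<in> Z" "e \<bullet> g \<le> e \<bullet> p"
        using ex_gradient_limit[OF z p, of e] by (auto simp: Z_def)
      then show False
        using e hull_inc[of g Z convex] by force
    qed
  qed
  moreover have "convex hull Z \<subseteq> superdiff u z"
    by (intro hull_minimal convex_superdiff z) (auto simp: Z_def)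
  ultimately have "q \<in> Z"
    using q extreme_point_of_convex_hull[of q Z] by (auto simp: superdiff_ext_def)
  then show ?thesis by (simp add: Z_def)
qed

end

section \<open>Convex and concave envelopes with extended real values\<close>

text \<open>Stands in for Jensen's inequality over combinations of extreme points: a bound on the
  extreme points extends to their convex hull by minimality of the hull. It is applied with
  \<open>c = - 1\<close> to the envelope of \<open>H\<close> and with \<open>c = 1\<close> to that
  of \<open>- H\<close>.\<close>

lemma convex_ereal_sublevel:
  fixes c :: real
  assumes "convex_ereal f"
  shows "convex {(\<eta>::real, p). f p \<le> ereal (c * \<eta>)}"
proof (rule convexI, clarsimp)
  fix \<eta> \<eta>' a b :: real and p p'
  assume *: "f p \<le> ereal (c * \<eta>)" "f p' \<le> ereal (c * \<eta>')" "0 \<le> a" "0 \<le> b" "a + b = 1"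
  have "f (a *\<^sub>R p + b *\<^sub>R p') \<le> ereal a * f p + ereal b * f p'"
    using assms * by (auto simp: convex_ereal_def)
  also have "\<dots> \<le> ereal a * ereal (c * \<eta>) + ereal b * ereal (c * \<eta>')"
    using * by (intro add_mono ereal_mult_left_mono) auto
  also have "\<dots> = ereal (c * (a * \<eta> + b * \<eta>'))"
    by (simp add: algebra_simps)
  finally show "f (a *\<^sub>R p + b *\<^sub>R p') \<le> ereal (c * (a * \<eta> + b * \<eta>'))" .
qed

text \<open>The greatest element is the pointwise supremum of all convex minorants, which is itself
  a convex minorant.\<close>

lemma convex_hull_fun_Greatest:
  assumes "\<And>p. p \<in> S \<Longrightarrow> c \<le> h p"
  shows convex_ereal_convex_hull_fun: "convex_ereal (convex_hull_fun S h)"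
    and convex_hull_fun_le: "p \<in> S \<Longrightarrow> convex_hull_fun S h p \<le> ereal (h p)"
    and convex_hull_fun_greatest: "convex_ereal g \<Longrightarrow> (\<And>p. p \<in> S \<Longrightarrow> g p \<le> ereal (h p)) \<Longrightarrow>
      g \<le> convex_hull_fun S h"
proof -
  define P where "P g \<longleftrightarrow> convex_ereal g \<and> (\<forall>p\<in>S. g p \<le> ereal (h p))" for g :: "'a \<Rightarrow> ereal"
  define F where "F x = (SUP g\<in>Collect P. g x)" for x
  have up: "g x \<le> F x" if "P g" for g x
    unfolding F_def using that by (auto intro: SUP_upper)
  \<comment> \<open>The constant \<open>c\<close> is a minorant, which keeps the supremum away from
    \<open>-\<infinity>\<close>.\<close>
  have const: "P (\<lambda>_. ereal c)"
  proof -
    have "ereal c \<le> ereal a * ereal c + ereal b * ereal c" if "a + b = 1" for a b :: real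
      using that by (simp add: distrib_right[symmetric])
    then show ?thesis using assms by (simp add: P_def convex_ereal_def)
  qed
  have "convex_ereal F"
    unfolding convex_ereal_def
  proof (intro conjI allI impI)
    show "F x \<noteq> - \<infinity>" for x
      using up[OF const, of x] by auto
    fix x y and a b :: real
    assume ab: "0 \<le> a" "0 \<le> b" "a + b = 1"
    show "F (a *\<^sub>R x + b *\<^sub>R y) \<le> ereal a * F x + ereal b * F y"
      unfolding F_def[of "a *\<^sub>R x + b *\<^sub>R y"]
    proof (rule SUP_least)
      fix g assume g: "g \<in> Collect P"
      then have "g (a *\<^sub>R x + b *\<^sub>R y) \<le> ereal a * g x + ereal b * g y"
        using ab by (auto simp: P_def convex_ereal_def)
      also have "\<dots> \<le> ereal a * F x + ereal b * F y"
        using ab g up by (intro add_mono ereal_mult_left_mono) auto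
      finally show "g (a *\<^sub>R x + b *\<^sub>R y) \<le> ereal a * F x + ereal b * F y" .
    qed
  qed
  moreover have "F p \<le> ereal (h p)" if "p \<in> S" for p
    unfolding F_def using that by (intro SUP_least) (auto simp: P_def)
  ultimately have "P F" by (simp add: P_def)
  then have "convex_hull_fun S h = F"
    unfolding convex_hull_fun_def P_def[symmetric]
    using up by (intro Greatest_equality) (auto simp: le_fun_def)
  with \<open>P F\<close> up show "convex_ereal (convex_hull_fun S h)" "p \<in> S \<Longrightarrow> convex_hull_fun S h p \<le> ereal (h p)"
    "convex_ereal g \<Longrightarrow> (\<And>p. p \<in> S \<Longrightarrow> g p \<le> ereal (h p)) \<Longrightarrow> g \<le> convex_hull_fun S h"
    by (auto simp: P_def le_fun_def)
qed

lemma ereal_le_uminus_reorder: "a \<le> - b \<longleftrightarrow> b \<le> - a" for a b :: ereal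
  using ereal_minus_le_minus[of a "- b"] ereal_minus_le_minus[of b "- a"] by auto

text \<open>Negation reverses the order and exchanges concave majorants of \<open>h\<close> with
  convex minorants of \<open>- h\<close>; the upper bound on \<open>h\<close> becomes the lower
  bound required for the convex envelope.\<close>

lemma concave_hull_fun_eq:
  assumes "\<And>p. p \<in> S \<Longrightarrow> h p \<le> c"
  shows "concave_hull_fun S h = (\<lambda>p. - convex_hull_fun S (\<lambda>p. - h p) p)"
  unfolding concave_hull_fun_def
proof (rule Least_equality)
  have c: "\<And>p. p \<in> S \<Longrightarrow> - c \<le> - h p" using assms by auto
  have "ereal (h p) \<le> - convex_hull_fun S (\<lambda>p. - h p) p" if "p \<in> S" for p
    using convex_hull_fun_le[of S "- c" "\<lambda>p. - h p" p] c that
    by (subst ereal_le_uminus_reorder) simp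
  then show "concave_ereal (\<lambda>p. - convex_hull_fun S (\<lambda>p. - h p) p) \<and>
      (\<forall>p\<in>S. ereal (h p) \<le> - convex_hull_fun S (\<lambda>p. - h p) p)"
    using convex_ereal_convex_hull_fun[of S "- c" "\<lambda>p. - h p"] c
    by (simp add: concave_ereal_def)
  fix g :: "'a \<Rightarrow> ereal"
  assume g: "concave_ereal g \<and> (\<forall>p\<in>S. ereal (h p) \<le> g p)"
  then have "(\<lambda>p. - g p) \<le> convex_hull_fun S (\<lambda>p. - h p)"
    using c by (intro convex_hull_fun_greatest[of S "- c"])
      (auto simp: concave_ereal_def simp flip: uminus_ereal.simps(1))
  then show "(\<lambda>p. - convex_hull_fun S (\<lambda>p. - h p) p) \<le> g"
    by (auto simp: le_fun_def ereal_uminus_le_reorder)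
qed

section \<open>The Hamilton-Jacobi equation on the strip\<close>

lemma open_strip: "open (strip T)"
  unfolding strip_def by (intro open_Times) auto

theorem theorem2:
  fixes H :: "real \<Rightarrow> (real ^ 'd) \<Rightarrow> (real ^ 'd) \<Rightarrow> real"
    and T :: real
    and u :: "real \<times> (real ^ 'd) \<Rightarrow> real"
  assumes "continuous_on UNIV (\<lambda>(t, x, p). H t x p)"
    and "T > 0"
    and "semiconcave_solution T H u"
  shows "((\<forall>(t, x)\<in>strip T. \<forall>p\<in>superdiff_x u t x. ereal (H t x p) \<le> H_check H u t x p)
            \<longrightarrow> viscosity_solution T H u) \<and>
         (viscosity_solution T H u
            \<longrightarrow> (\<forall>(t, x)\<in>strip T. \<forall>p\<in>superdiff_x u t x. ereal (H t x p) \<le> H_hat H u t x p))"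
proof -
  obtain B where B: "concave_on (strip T) (\<lambda>z. u z - B * (norm z)\<^sup>2 / 2)"
    using assms(3) by (auto simp: semiconcave_solution_def semiconcave_on_def)
  interpret semiconcave "strip T" u B
    using open_strip B by unfold_locales
  have equation: "\<eta> + H t x p = 0" if "(t, x) \<in> strip T" "GDERIV u (t, x) :> (\<eta>, p)" for t x \<eta> p
    using assms(3) that by (auto simp: semiconcave_solution_def)
  let ?G = "{(w, g). w \<in> strip T \<and> GDERIV u w :> g}"
  let ?Z = "{(w, g). fst g + H (fst w) (snd w) (snd g) = 0}"
  have cont: "continuous_on UNIV (\<lambda>y. H (a y) (b y) (p y))"
    if "continuous_on UNIV a" "continuous_on UNIV b" "continuous_on UNIV p"
    for a b and p :: "'b::topological_space \<Rightarrow> _"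
  proof -
    have "continuous_on UNIV (\<lambda>y. (a y, b y, p y))"
      by (intro continuous_on_Pair that)
    from continuous_on_compose2[OF assms(1) this] show ?thesis by simp
  qed
  \<comment> \<open>Continuity of \<open>H\<close> makes the equation a closed condition on pairs of
    point and gradient, so it survives in limits of gradients.\<close>
  have "closed ?Z"
    unfolding case_prod_beta by (intro closed_Collect_eq continuous_intros cont)
  moreover have "?G \<subseteq> ?Z"
    using equation by force
  ultimately have "closure ?G \<subseteq> ?Z"
    by (rule closure_minimal[rotated])
  then have ext: "\<eta> + H t x p = 0" if "(t, x) \<in> strip T" "(\<eta>, p) \<in> superdiff_ext u (t, x)" for t x \<eta> p
    using superdiff_ext_gradient_limit[OF that] by auto
  have hull: "superdiff u (t, x) = convex hull superdiff_ext u (t, x)" if "(t, x) \<in> strip T" for t x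
    unfolding superdiff_ext_def
    using that by (intro Krein_Milman_Minkowski compact_superdiff convex_superdiff)
  \<comment> \<open>Supplies the constants under which the envelopes exist: \<open>H t x\<close> is
    bounded on the compact superdifferential.\<close>
  have bdd: "\<exists>c. \<forall>p\<in>superdiff_ext_x u t x. \<bar>H t x p\<bar> \<le> c" if "(t, x) \<in> strip T" for t x
  proof -
    have "continuous_on UNIV (\<lambda>q :: real \<times> (real^'d). H t x (snd q))"
      by (intro cont continuous_intros)
    then have "compact ((\<lambda>q. H t x (snd q)) ` superdiff u (t, x))"
      using compact_continuous_image[OF continuous_on_subset compact_superdiff[OF that]] by blast
    then have "bounded ((\<lambda>q. H t x (snd q)) ` superdiff u (t, x))"
      by (rule compact_imp_bounded)
    then obtain c where "\<And>q. q \<in> superdiff u (t, x) \<Longrightarrow> \<bar>H t x (snd q)\<bar> \<le> c"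
      unfolding bounded_iff by (metis image_eqI real_norm_def)
    then have "\<forall>p\<in>superdiff_ext_x u t x. \<bar>H t x p\<bar> \<le> c"
      by (force simp: superdiff_ext_x_def superdiff_ext_def extreme_point_of_def)
    then show ?thesis ..
  qed
  have sub: "{(\<eta>, p). \<eta> + H t x p \<le> 0} \<supseteq> superdiff u (t, x)"
    if z: "(t, x) \<in> strip T"
      and H: "\<forall>p\<in>superdiff_x u t x. ereal (H t x p) \<le> H_check H u t x p" for t x
  proof -
    obtain c where "\<And>p. p \<in> superdiff_ext_x u t x \<Longrightarrow> \<bar>H t x p\<bar> \<le> c"
      using bdd[OF z] by blast
    then have c: "\<And>p. p \<in> superdiff_ext_x u t x \<Longrightarrow> - c \<le> H t x p"
      by fastforce
    let ?C = "{(\<eta>, p). H_check H u t x p \<le> ereal (- 1 * \<eta>)}"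
    \<comment> \<open>At extreme points the equation gives \<open>H t x p = - \<eta>\<close>, and
      the convex envelope lies below \<open>H t x\<close> there.\<close>
    have "superdiff_ext u (t, x) \<subseteq> ?C"
    proof clarify
      fix \<eta> p assume "(\<eta>, p) \<in> superdiff_ext u (t, x)"
      then have "p \<in> superdiff_ext_x u t x" "H t x p = - \<eta>"
        using ext[OF z, of \<eta> p] by (auto simp: superdiff_ext_x_def)
      then show "H_check H u t x p \<le> ereal (- 1 * \<eta>)"
        using convex_hull_fun_le[of "superdiff_ext_x u t x" "- c" "H t x" p] c
        by (simp add: H_check_def)
    qed
    moreover have "convex ?C"
      unfolding H_check_def using c by (intro convex_ereal_sublevel convex_ereal_convex_hull_fun)
    ultimately have C: "superdiff u (t, x) \<subseteq> ?C"
      unfolding hull[OF z] by (rule hull_minimal)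
    show ?thesis
    proof clarify
      fix \<eta> p assume *: "(\<eta>, p) \<in> superdiff u (t, x)"
      then have "ereal (H t x p) \<le> H_check H u t x p"
        using H by (auto simp: superdiff_x_def)
      also have "\<dots> \<le> ereal (- \<eta>)"
        using C * by auto
      finally show "\<eta> + H t x p \<le> 0" by simp
    qed
  qed
  have sup: "ereal (H t x p) \<le> H_hat H u t x p"
    if z: "(t, x) \<in> strip T" and v: "viscosity_solution T H u" and p: "p \<in> superdiff_x u t x" for t x p
  proof -
    obtain c where "\<And>p. p \<in> superdiff_ext_x u t x \<Longrightarrow> \<bar>H t x p\<bar> \<le> c"
      using bdd[OF z] by blast
    then have c: "\<And>p. p \<in> superdiff_ext_x u t x \<Longrightarrow> H t x p \<le> c"
      and c': "\<And>p. p \<in> superdiff_ext_x u t x \<Longrightarrow> - c \<le> - H t x p"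
      by fastforce+
    let ?f = "convex_hull_fun (superdiff_ext_x u t x) (\<lambda>p. - H t x p)"
    let ?C = "{(\<eta>, p). ?f p \<le> ereal (1 * \<eta>)}"
    obtain \<eta> where \<eta>: "(\<eta>, p) \<in> superdiff u (t, x)"
      using p by (auto simp: superdiff_x_def)
    have "superdiff_ext u (t, x) \<subseteq> ?C"
    proof clarify
      fix \<eta> p assume "(\<eta>, p) \<in> superdiff_ext u (t, x)"
      then have "p \<in> superdiff_ext_x u t x" "H t x p = - \<eta>"
        using ext[OF z, of \<eta> p] by (auto simp: superdiff_ext_x_def)
      then show "?f p \<le> ereal (1 * \<eta>)"
        using convex_hull_fun_le[of "superdiff_ext_x u t x" "- c" "\<lambda>p. - H t x p" p] c'
        by simp
    qed
    moreover have "convex ?C"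
      using c' by (intro convex_ereal_sublevel convex_ereal_convex_hull_fun)
    ultimately have "superdiff u (t, x) \<subseteq> ?C"
      unfolding hull[OF z] by (rule hull_minimal)
    then have "?f p \<le> ereal \<eta>"
      using \<eta> by auto
    \<comment> \<open>The viscosity inequality is tested with a smooth function touching
      \<open>u\<close> from above with gradient \<open>(\<eta>, p)\<close>.\<close>
    moreover have "\<eta> + H t x p \<le> 0"
    proof -
      obtain \<phi> where "smooth_on UNIV \<phi>" "contact_above \<phi> u (t, x)" "GDERIV \<phi> (t, x) :> (\<eta>, p)"
        using smooth_contact_above_superdiff[OF z \<eta>] .
      then show ?thesis
        using v z open_UNIV unfolding viscosity_solution_def by blast
    qed
    then have "ereal \<eta> \<le> - ereal (H t x p)"
      by simp
    ultimately have "?f p \<le> - ereal (H t x p)"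
      by (rule order_trans)
    moreover have "H_hat H u t x p = - ?f p"
      using concave_hull_fun_eq[of "superdiff_ext_x u t x" "H t x" c] c by (simp add: H_hat_def)
    ultimately show ?thesis
      by (simp only: ereal_le_uminus_reorder)
  qed
  show ?thesis
  proof (intro conjI impI)
    assume H: "\<forall>(t, x)\<in>strip T. \<forall>p\<in>superdiff_x u t x. ereal (H t x p) \<le> H_check H u t x p"
    show "viscosity_solution T H u"
      unfolding viscosity_solution_def
    proof (intro conjI allI impI continuous_on_u)
      fix t x U \<eta> p and \<phi> :: "real \<times> (real ^ 'd) \<Rightarrow> real"
      assume *: "(t, x) \<in> strip T" "open U" "(t, x) \<in> U" "smooth_on U \<phi>" "GDERIV \<phi> (t, x) :> (\<eta>, p)"
      show "\<eta> + H t x p \<le> 0" if "contact_above \<phi> u (t, x)"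
      proof -
        have "(\<eta>, p) \<in> superdiff u (t, x)"
          unfolding superdiff_def using * that smooth_on_imp_C1 by blast
        then show ?thesis using sub[of t x] H * by auto
      qed
      show "\<eta> + H t x p \<ge> 0" if "contact_below \<phi> u (t, x)"
        \<comment> \<open>A contact from below forces \<open>u\<close> to be differentiable with
          gradient \<open>(\<eta>, p)\<close>, so the equation holds with equality.\<close>
        using equation[of t x \<eta> p] GDERIV_if_contact_below[OF _ that] * by auto
    qed
  next
    assume "viscosity_solution T H u"
    then show "\<forall>(t, x)\<in>strip T. \<forall>p\<in>superdiff_x u t x. ereal (H t x p) \<le> H_hat H u t x p"
      using sup by blast
  qed
qed

end
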